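(* Let $q$ be a prime power, $k=\mathbb{F}_q$, $n\ge 1$ an integer, and $h\in k^*$. Then $$N_0=\frac{q^{\binom{n}{2}}(q-1)}{q}\left((-1)^n+\prod_{i=2}^{n}(q^i-1)\right),$$ $$N_h=\frac{q^{\binom{n}{2}}(q-1)}{q}\left(\frac{(-1)^{n-1}}{q-1}+\prod_{i=2}^{n}(q^i-1)\right).$$
   Context: For $\beta\in k$, $N_\beta=\#\{X\in \mathrm{GL}_n(k) : \operatorname{tr} X=\beta\}$ is the number of invertible $n\times n$ matrices over $k$ with trace $\beta$. Empty products equal $1$. *)

theory Defs
  imports Complex_Main "HOL-Library.Cardinality" "Jordan_Normal_Form.Matrix"
begin

(* Meaningful for square matrices, the only ones it is applied to below. *)
definition mat_trace :: "'a::comm_monoid_add mat \<Rightarrow> 'a" where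
  "mat_trace A = (\<Sum>i<dim_row A. A $$ (i, i))"

definition GL :: "nat \<Rightarrow> 'a::field mat set" where
  "GL n = {X \<in> carrier_mat n n. invertible_mat X}"

definition num_GL_trace :: "nat \<Rightarrow> 'a::{field,finite} \<Rightarrow> nat" where
  "num_GL_trace n \<beta> = card {X \<in> GL n. mat_trace X = \<beta>}"

end

theory Submission
  imports Defs "Jordan_Normal_Form.Determinant"
begin

text \<open>For \<open>f\<close> on the field \<open>k\<close> with total sum zero, put \<open>S\<^sub>n(f)\<close> for the sum of
  \<open>f (tr X)\<close> over \<open>X\<close> in \<open>GL\<^sub>n(k)\<close>. Fix all columns of \<open>X\<close> but the last and let \<open>W\<close> be the hyperplane
  they span. The last column ranges over the complement of \<open>W\<close>; as \<open>f\<close> sums to zero, this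
  contributes minus the sum over \<open>W\<close>, which vanishes unless the last coordinate is zero on \<open>W\<close>.
  Hence \<open>S\<^sub>n(f) = - q^(n-1) S\<^sub>n\<^sub>-\<^sub>1(f)\<close>. Taking for \<open>f\<close> the indicator of \<open>0\<close> minus that of \<open>h\<close>
  yields \<open>N\<^sub>0 - N\<^sub>h = (-1)^n q^(n choose 2)\<close>, and the sum of all \<open>N\<^sub>\<beta>\<close> is the order of \<open>GL\<^sub>n(k)\<close>.\<close>

section \<open>Finiteness and size of matrix and vector spaces\<close>

lemma finite_carrier_mat: "finite (carrier_mat n m :: 'a::finite mat set)"
proof (rule finite_subset)
  show "carrier_mat n m \<subseteq> mat n m ` (({..<n} \<times> {..<m}) \<rightarrow>\<^sub>E (UNIV :: 'a set))"
  proof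
    fix A :: "'a mat" assume A: "A \<in> carrier_mat n m"
    have "A = mat n m (restrict (($$) A) ({..<n} \<times> {..<m}))"
      using A by (intro eq_matI) auto
    then show "A \<in> mat n m ` (({..<n} \<times> {..<m}) \<rightarrow>\<^sub>E UNIV)"
      by (metis (no_types, lifting) UNIV_I image_eqI restrict_PiE_iff)
  qed
qed (auto intro!: finite_PiE)

text \<open>Lets finiteness and cardinality of \<open>carrier_vec n\<close> be inherited from lists
  of fixed length.\<close>

lemma carrier_vec_conv_lists: "carrier_vec n = vec_of_list ` {xs. length xs = n}"
proof (intro equalityI subsetI)
  fix v :: "'a vec" assume "v \<in> carrier_vec n"
  then show "v \<in> vec_of_list ` {xs. length xs = n}"
    by (intro image_eqI[of _ _ "list_of_vec v"]) (auto simp: vec_list)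
qed (auto intro!: carrier_vecI)

lemma finite_carrier_vec: "finite (carrier_vec n :: 'a::finite vec set)"
  using finite_lists_length_eq[of "UNIV :: 'a set" n] by (simp add: carrier_vec_conv_lists)

lemma card_carrier_vec: "card (carrier_vec n :: 'a::finite vec set) = CARD('a) ^ n"
proof -
  have "inj_on vec_of_list {xs :: 'a list. length xs = n}"
    by (metis inj_onI list_vec)
  then show ?thesis
    using card_lists_length_eq[of "UNIV :: 'a set" n]
    by (simp add: carrier_vec_conv_lists card_image)
qed

section \<open>Matrices with independent columns\<close>

text \<open>Rectangular shapes are needed because matrices are built one column at a time.
  Independence is stated as triviality of the kernel, which meets the determinant criterion directly
  when \<open>m = n\<close>.\<close>

definition indep_cols :: "nat \<Rightarrow> nat \<Rightarrow> 'a::field mat set" where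
  "indep_cols n m =
     {A \<in> carrier_mat n m. \<forall>v \<in> carrier_vec m. A *\<^sub>v v = 0\<^sub>v n \<longrightarrow> v = 0\<^sub>v m}"

definition append_col :: "'a mat \<Rightarrow> 'a vec \<Rightarrow> 'a mat" where
  "append_col A x = mat (dim_row A) (Suc (dim_col A))
     (\<lambda>(i, j). if j < dim_col A then A $$ (i, j) else x $ i)"

text \<open>Embeds matrices with \<open>n\<close> rows as those with one row more whose column span
  lies in the hyperplane where the last coordinate is zero.\<close>

definition append_zero_row :: "'a::zero mat \<Rightarrow> 'a mat" where
  "append_zero_row A = mat (Suc (dim_row A)) (dim_col A)
     (\<lambda>(i, j). if i < dim_row A then A $$ (i, j) else 0)"

lemma finite_indep_cols: "finite (indep_cols n m :: 'a::{field,finite} mat set)"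
  unfolding indep_cols_def using finite_carrier_mat by (rule rev_finite_subset) auto

lemma indep_cols_carrier: "A \<in> indep_cols n m \<Longrightarrow> A \<in> carrier_mat n m"
  by (simp add: indep_cols_def)

text \<open>Both sides amount to a nonzero determinant.\<close>

lemma GL_eq_indep_cols: "GL n = indep_cols n n"
proof (rule Set.set_eqI)
  fix A :: "'a mat"
  show "A \<in> GL n \<longleftrightarrow> A \<in> indep_cols n n"
  proof (cases "A \<in> carrier_mat n n")
    case A: True
    have "invertible_mat A \<longleftrightarrow> det A \<noteq> 0"
    proof
      assume "invertible_mat A"
      then obtain B where B: "A * B = 1\<^sub>m (dim_row A)" "B * A = 1\<^sub>m (dim_row B)"
        by (auto simp: invertible_mat_def inverts_mat_def)
      \<comment> \<open>\<open>invertible_mat\<close> leaves the shape of the inverse open; it is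
        read off from the two products.\<close>
      have "dim_col B = n" "dim_row B = n"
        using arg_cong[OF B(1), of dim_col] arg_cong[OF B(2), of dim_col] A by simp_all
      then have "A * B = 1\<^sub>m n" "B \<in> carrier_mat n n"
        using A B by auto
      then have "det A * det B = 1" using A by (simp flip: det_mult)
      then show "det A \<noteq> 0" by auto
    next
      assume "det A \<noteq> 0"
      from det_non_zero_imp_unit[OF A this, of "()"]
      obtain B where "B \<in> carrier_mat n n" "A * B = 1\<^sub>m n" "B * A = 1\<^sub>m n"
        by (auto simp: Units_def ring_mat_def)
      then show "invertible_mat A"
        using A unfolding invertible_mat_def inverts_mat_def
        by (intro conjI exI[of _ B]) auto
    qed
    also have "\<dots> \<longleftrightarrow> (\<forall>v \<in> carrier_vec n. A *\<^sub>v v = 0\<^sub>v n \<longrightarrow> v = 0\<^sub>v n)"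
      unfolding det_0_iff_vec_prod_zero_field[OF A] by blast
    finally show ?thesis
      using A by (simp add: GL_def indep_cols_def)
  qed (auto simp: GL_def indep_cols_def)
qed

lemma indep_cols_inj_on:
  assumes "A \<in> indep_cols n m"
  shows "inj_on ((*\<^sub>v) A) (carrier_vec m)"
proof (rule inj_onI)
  fix v w assume vw: "v \<in> carrier_vec m" "w \<in> carrier_vec m" "A *\<^sub>v v = A *\<^sub>v w"
  have A: "A \<in> carrier_mat n m" using assms by (rule indep_cols_carrier)
  have "A *\<^sub>v (v - w) = A *\<^sub>v v - A *\<^sub>v w"
    using A vw by (simp add: mult_minus_distrib_mat_vec)
  also have "\<dots> = 0\<^sub>v n" using A vw by simp
  finally have 0: "v - w = 0\<^sub>v m" using assms vw by (simp add: indep_cols_def)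
  show "v = w"
  proof (rule eq_vecI)
    fix i assume "i < dim_vec w"
    then show "v $ i = w $ i"
      using arg_cong[OF 0, of "\<lambda>u. u $ i"] vw by simp
  qed (use vw in simp)
qed

section \<open>Adjoining a column\<close>

lemma append_col_carrier [simp]:
  "A \<in> carrier_mat n m \<Longrightarrow> append_col A x \<in> carrier_mat n (Suc m)"
  by (simp add: append_col_def)

lemma append_col_mult_vec:
  fixes A :: "'a::field mat"
  assumes A: "A \<in> carrier_mat n m" and x: "x \<in> carrier_vec n" and v: "v \<in> carrier_vec (Suc m)"
  shows "append_col A x *\<^sub>v v = A *\<^sub>v vec_first v m + v $ m \<cdot>\<^sub>v x"
proof (rule eq_vecI)
  fix i assume "i < dim_vec (A *\<^sub>v vec_first v m + v $ m \<cdot>\<^sub>v x)"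
  then have i: "i < n" using x by simp
  show "(append_col A x *\<^sub>v v) $ i = (A *\<^sub>v vec_first v m + v $ m \<cdot>\<^sub>v x) $ i"
    using A x v i by (simp add: append_col_def scalar_prod_def vec_first_def)
qed (use A x in \<open>auto simp: append_col_def\<close>)

lemma append_col_inj:
  assumes "A \<in> carrier_mat n m" "B \<in> carrier_mat n m" "x \<in> carrier_vec n" "y \<in> carrier_vec n"
    and eq: "append_col A x = append_col B y"
  shows "A = B \<and> x = y"
proof
  have *: "append_col A x $$ (i, j) = append_col B y $$ (i, j)" for i j using eq by simp
  show "A = B"
  proof (rule eq_matI)
    fix i j assume "i < dim_row B" "j < dim_col B"
    then show "A $$ (i, j) = B $$ (i, j)"
      using *[of i j] assms(1-4) by (simp add: append_col_def)
  qed (use assms in auto)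
  show "x = y"
  proof (rule eq_vecI)
    fix i assume "i < dim_vec y"
    then show "x $ i = y $ i" using *[of i m] assms(1-4) by (simp add: append_col_def)
  qed (use assms in auto)
qed

text \<open>A linear relation among the columns of \<open>append_col A x\<close> either has
  coefficient 0 at \<open>x\<close>, and is then a relation among the columns of \<open>A\<close>,
  or it can be solved for \<open>x\<close>, which then lies in their span.\<close>

lemma append_col_indep_iff:
  fixes A :: "'a::field mat"
  assumes A: "A \<in> carrier_mat n m" and x: "x \<in> carrier_vec n"
  shows "append_col A x \<in> indep_cols n (Suc m) \<longleftrightarrow>
           A \<in> indep_cols n m \<and> x \<notin> (*\<^sub>v) A ` carrier_vec m"
proof
  assume L: "append_col A x \<in> indep_cols n (Suc m)"
  have ker: "w = 0\<^sub>v m \<and> a = 0" if w: "w \<in> carrier_vec m" and 0: "A *\<^sub>v w + a \<cdot>\<^sub>v x = 0\<^sub>v n" for w a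
  proof -
    \<comment> \<open>Glues the coefficients \<open>w\<close> of \<open>A\<close> and
      \<open>a\<close> of \<open>x\<close> into one vector for the extended matrix.\<close>
    define v where "v = vec (Suc m) (\<lambda>i. if i < m then w $ i else a)"
    have v: "v \<in> carrier_vec (Suc m)" "vec_first v m = w" "v $ m = a"
      using w by (auto simp: v_def vec_first_def intro!: eq_vecI)
    have "v = 0\<^sub>v (Suc m)"
      using L append_col_mult_vec[OF A x v(1)] v 0 by (simp add: indep_cols_def)
    then show ?thesis using v by (auto simp: vec_first_def)
  qed
  have "A \<in> indep_cols n m"
    unfolding indep_cols_def
  proof (intro CollectI conjI ballI impI A)
    fix w assume "w \<in> carrier_vec m" "A *\<^sub>v w = 0\<^sub>v n"
    then show "w = 0\<^sub>v m" using ker[of w 0] x A by (auto simp: vec_eq_iff)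
  qed
  moreover have "x \<notin> (*\<^sub>v) A ` carrier_vec m"
  proof
    assume "x \<in> (*\<^sub>v) A ` carrier_vec m"
    then obtain w where w: "w \<in> carrier_vec m" "x = A *\<^sub>v w" by auto
    have "A *\<^sub>v w + (-1) \<cdot>\<^sub>v x = 0\<^sub>v n" using w A by (intro eq_vecI) auto
    from ker[OF w(1) this] show False by simp
  qed
  ultimately show "A \<in> indep_cols n m \<and> x \<notin> (*\<^sub>v) A ` carrier_vec m" ..
next
  assume R: "A \<in> indep_cols n m \<and> x \<notin> (*\<^sub>v) A ` carrier_vec m"
  show "append_col A x \<in> indep_cols n (Suc m)"
    unfolding indep_cols_def
  proof (intro CollectI conjI ballI impI append_col_carrier[OF A])
    fix v assume v: "v \<in> carrier_vec (Suc m)" and "append_col A x *\<^sub>v v = 0\<^sub>v n"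
    then have 0: "A *\<^sub>v vec_first v m + v $ m \<cdot>\<^sub>v x = 0\<^sub>v n"
      by (simp add: append_col_mult_vec[OF A x])
    have last: "v $ m = 0"
    proof (rule ccontr)
      assume nz: "v $ m \<noteq> 0"
      \<comment> \<open>The coefficients obtained by solving the relation for
        \<open>x\<close>.\<close>
      let ?w = "(- inverse (v $ m)) \<cdot>\<^sub>v vec_first v m"
      have "x = A *\<^sub>v ?w"
      proof (rule eq_vecI)
        fix i assume i: "i < dim_vec (A *\<^sub>v ?w)"
        then have i': "i < n" using A by simp
        have "(A *\<^sub>v vec_first v m + v $ m \<cdot>\<^sub>v x) $ i = 0" using 0 i' by simp
        then have "(A *\<^sub>v vec_first v m) $ i + v $ m * x $ i = 0" using A x i' by simp
        then show "x $ i = (A *\<^sub>v ?w) $ i"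
          using nz i' A x by (simp add: mult_mat_vec[OF A] field_simps eq_neg_iff_add_eq_0)
      qed (use A x in auto)
      with R show False by auto
    qed
    have "A *\<^sub>v vec_first v m = 0\<^sub>v n" using 0 last A x by (auto simp: vec_eq_iff)
    then have "vec_first v m = 0\<^sub>v m" using R by (auto simp: indep_cols_def)
    then have "v $ i = 0" if "i < m" for i
      using that by (metis index_vec index_zero_vec(1) vec_first_def)
    then show "v = 0\<^sub>v (Suc m)"
      using v last by (intro eq_vecI) (auto simp: less_Suc_eq)
  qed
qed

text \<open>Splitting off the last column is the inverse. The domain is a dependent sum because the
  span that \<open>x\<close> must avoid varies with \<open>A\<close>.\<close>

lemma bij_betw_append_col:
  "bij_betw (\<lambda>(A, x). append_col A x)
     (SIGMA A : indep_cols n m. carrier_vec n - (*\<^sub>v) A ` carrier_vec m)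
     (indep_cols n (Suc m) :: 'a::field mat set)"
  unfolding bij_betw_def
proof (intro conjI inj_onI equalityI subsetI)
  fix X :: "'a mat" assume X: "X \<in> indep_cols n (Suc m)"
  then have c: "X \<in> carrier_mat n (Suc m)" by (rule indep_cols_carrier)
  define A x where "A = mat n m (($$) X)" and "x = col X m"
  have A: "A \<in> carrier_mat n m" and x: "x \<in> carrier_vec n"
    using c by (auto simp: A_def x_def)
  have eq: "X = append_col A x"
    using c by (intro eq_matI) (auto simp: append_col_def A_def x_def less_Suc_eq)
  with X show "X \<in> (\<lambda>(A, x). append_col A x) `
      (SIGMA A : indep_cols n m. carrier_vec n - (*\<^sub>v) A ` carrier_vec m)"
    using append_col_indep_iff[OF A x] x by (intro image_eqI[of _ _ "(A, x)"]) auto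
next
  fix p p' :: "'a mat \<times> 'a vec"
  assume p: "p \<in> (SIGMA A : indep_cols n m. carrier_vec n - (*\<^sub>v) A ` carrier_vec m)"
    "p' \<in> (SIGMA A : indep_cols n m. carrier_vec n - (*\<^sub>v) A ` carrier_vec m)"
    "(case p of (A, x) \<Rightarrow> append_col A x) = (case p' of (A, x) \<Rightarrow> append_col A x)"
  then show "p = p'"
    using append_col_inj[of "fst p" n m "fst p'" "snd p" "snd p'"]
    by (auto dest!: indep_cols_carrier)
qed (auto simp: append_col_indep_iff[OF indep_cols_carrier])

section \<open>Summation over the last column\<close>

text \<open>The sum over admissible last columns is the sum over all vectors minus the sum over the
  span of \<open>A\<close>. Independence makes \<open>c\<close> a faithful coordinate on that span,
  so no vector is subtracted twice.\<close>

lemma sum_indep_cols_Suc: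
  fixes F :: "'a::{field,finite} mat \<Rightarrow> 'b::ab_group_add"
  shows "sum F (indep_cols n (Suc m)) =
    (\<Sum>A\<in>indep_cols n m. (\<Sum>x\<in>carrier_vec n. F (append_col A x)) -
       (\<Sum>c\<in>carrier_vec m. F (append_col A (A *\<^sub>v c))))"
proof -
  have "sum F (indep_cols n (Suc m)) =
    (\<Sum>(A, x)\<in>(SIGMA A : indep_cols n m. carrier_vec n - (*\<^sub>v) A ` carrier_vec m).
       F (append_col A x))"
    by (subst sum.reindex_bij_betw[OF bij_betw_append_col, symmetric])
      (simp add: case_prod_unfold)
  also have "\<dots> = (\<Sum>A\<in>indep_cols n m. \<Sum>x\<in>carrier_vec n - (*\<^sub>v) A ` carrier_vec m. F (append_col A x))"
    by (subst sum.Sigma) (auto simp: finite_indep_cols finite_carrier_vec)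
  also have "\<dots> = (\<Sum>A\<in>indep_cols n m. (\<Sum>x\<in>carrier_vec n. F (append_col A x)) -
       (\<Sum>c\<in>carrier_vec m. F (append_col A (A *\<^sub>v c))))"
  proof (rule sum.cong[OF refl])
    fix A :: "'a mat" assume A: "A \<in> indep_cols n m"
    then have "A \<in> carrier_mat n m" by (rule indep_cols_carrier)
    then have "(*\<^sub>v) A ` carrier_vec m \<subseteq> carrier_vec n" by auto
    then show "(\<Sum>x\<in>carrier_vec n - (*\<^sub>v) A ` carrier_vec m. F (append_col A x)) =
       (\<Sum>x\<in>carrier_vec n. F (append_col A x)) - (\<Sum>c\<in>carrier_vec m. F (append_col A (A *\<^sub>v c)))"
      by (simp add: sum_diff finite_carrier_vec sum.reindex[OF indep_cols_inj_on[OF A]] o_def)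
  qed
  finally show ?thesis .
qed

lemma indep_cols_0: "indep_cols n 0 = {0\<^sub>m n 0}"
  by (auto simp: indep_cols_def)

text \<open>Taking the constant function 1 in \<open>sum_indep_cols_Suc\<close> shows that, with
  \<open>q = CARD('a)\<close>, each matrix with \<open>m\<close> independent columns has
  \<open>q^n - q^m\<close> extensions.\<close>

lemma card_indep_cols:
  "real (card (indep_cols n m :: 'a::{field,finite} mat set)) =
     (\<Prod>i<m. real CARD('a) ^ n - real CARD('a) ^ i)"
proof (induction m)
  case (Suc m)
  have "real (card (indep_cols n (Suc m) :: 'a mat set)) = (\<Sum>A\<in>(indep_cols n (Suc m) :: 'a mat set). 1)"
    by simp
  also have "\<dots> = real (card (indep_cols n m :: 'a mat set)) * (real CARD('a) ^ n - real CARD('a) ^ m)"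
    by (subst sum_indep_cols_Suc) (simp add: card_carrier_vec)
  finally show ?case by (simp add: Suc.IH)
qed (simp add: indep_cols_0)

text \<open>Translating by multiples of \<open>u\<close> averages \<open>f\<close> over all of \<open>'a\<close>.\<close>
lemma sum_linear_functional_eq_0:
  fixes f :: "'a::{field,finite} \<Rightarrow> real" and g :: "'a vec \<Rightarrow> 'a"
  assumes f: "sum f UNIV = 0" and u: "u \<in> carrier_vec n" "g u = 1"
    and g: "\<And>c s. c \<in> carrier_vec n \<Longrightarrow> g (c + s \<cdot>\<^sub>v u) = g c + s * g u"
  shows "(\<Sum>c\<in>carrier_vec n. f (t + g c)) = 0"
proof -
  let ?S = "\<Sum>c\<in>carrier_vec n. f (t + g c)"
  have shift: "?S = (\<Sum>c\<in>carrier_vec n. f (t + g c + s))" for s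
  proof -
    have "bij_betw (\<lambda>c. c + s \<cdot>\<^sub>v u) (carrier_vec n) (carrier_vec n)"
      by (rule bij_betw_byWitness[where f' = "\<lambda>c. c - s \<cdot>\<^sub>v u"]) (use u in \<open>auto intro!: eq_vecI\<close>)
    from sum.reindex_bij_betw[OF this, of "\<lambda>c. f (t + g c)"] show ?thesis
      using u g by (simp add: add.assoc)
  qed
  have "real CARD('a) * ?S = (\<Sum>s\<in>(UNIV :: 'a set). ?S)" by simp
  also have "\<dots> = (\<Sum>s\<in>UNIV. \<Sum>c\<in>carrier_vec n. f (t + g c + s))"
    by (rule sum.cong[OF refl shift])
  also have "\<dots> = (\<Sum>c\<in>carrier_vec n. \<Sum>s\<in>UNIV. f (t + g c + s))" by (rule sum.swap)
  also have "\<dots> = 0"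
  proof (rule sum.neutral, rule ballI)
    fix c
    have "bij (\<lambda>s. t + g c + s)" by (rule bij_betw_byWitness[where f' = "\<lambda>s. s - (t + g c)"]) auto
    from sum.reindex_bij_betw[OF this, of f] show "(\<Sum>s\<in>UNIV. f (t + g c + s)) = 0" by (simp add: f)
  qed
  finally show ?thesis by simp
qed

section \<open>Zero last rows and the trace recursion\<close>

lemma append_zero_row_mult_vec:
  assumes "A \<in> carrier_mat n m" "v \<in> carrier_vec m"
  shows "append_zero_row A *\<^sub>v v = (0\<^sub>v (Suc n) :: 'a::field vec) \<longleftrightarrow> A *\<^sub>v v = 0\<^sub>v n"
proof -
  have "(append_zero_row A *\<^sub>v v) $ i = (if i < n then (A *\<^sub>v v) $ i else 0)" if "i < Suc n" for i
    using assms that by (auto simp: append_zero_row_def scalar_prod_def)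
  moreover have "dim_vec (append_zero_row A *\<^sub>v v) = Suc n" "dim_vec (A *\<^sub>v v) = n"
    using assms by (auto simp: append_zero_row_def)
  ultimately show ?thesis
    by (auto simp: vec_eq_iff less_Suc_eq)
qed

text \<open>A zero row adds no condition to \<open>A *\<^sub>v v = 0\<close>, so independence is
  preserved in both directions; deleting the row is the inverse.\<close>

lemma bij_betw_append_zero_row:
  "bij_betw append_zero_row (indep_cols n m)
     {A \<in> indep_cols (Suc n) m. \<forall>j<m. A $$ (n, j) = (0 :: 'a::field)}"
proof (rule bij_betw_byWitness[where f' = "\<lambda>A. mat n m (($$) A)"])
  have indep: "append_zero_row A \<in> indep_cols (Suc n) m \<longleftrightarrow> A \<in> indep_cols n m"
    if "A \<in> carrier_mat n m" for A :: "'a mat"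
  proof -
    have "append_zero_row A \<in> carrier_mat (Suc n) m"
      using that by (simp add: append_zero_row_def)
    then show ?thesis
      using that by (simp add: indep_cols_def append_zero_row_mult_vec[OF that])
  qed
  have restrict: "append_zero_row (mat n m (($$) A)) = A"
    if "A \<in> carrier_mat (Suc n) m" "\<forall>j<m. A $$ (n, j) = 0" for A :: "'a mat"
    using that by (intro eq_matI) (auto simp: append_zero_row_def less_Suc_eq)
  show "\<forall>A\<in>indep_cols n m. mat n m (($$) (append_zero_row A)) = (A :: 'a mat)"
    by (auto simp: append_zero_row_def dest!: indep_cols_carrier intro!: eq_matI)
  show "\<forall>A\<in>{A \<in> indep_cols (Suc n) m. \<forall>j<m. A $$ (n, j) = (0 :: 'a)}.
      append_zero_row (mat n m (($$) A)) = A"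
    using restrict by (auto dest: indep_cols_carrier)
  show "append_zero_row ` indep_cols n m \<subseteq>
      {A \<in> indep_cols (Suc n) m. \<forall>j<m. A $$ (n, j) = (0 :: 'a)}"
  proof (intro image_subsetI CollectI conjI)
    fix A :: "'a mat" assume A: "A \<in> indep_cols n m"
    then have c: "A \<in> carrier_mat n m" by (rule indep_cols_carrier)
    show "append_zero_row A \<in> indep_cols (Suc n) m" using indep[OF c] A by simp
    show "\<forall>j<m. append_zero_row A $$ (n, j) = 0" using c by (auto simp: append_zero_row_def)
  qed
  show "(\<lambda>A. mat n m (($$) A)) ` {A \<in> indep_cols (Suc n) m. \<forall>j<m. A $$ (n, j) = (0 :: 'a)}
      \<subseteq> indep_cols n m"
  proof (intro image_subsetI)
    fix A :: "'a mat" assume "A \<in> {A \<in> indep_cols (Suc n) m. \<forall>j<m. A $$ (n, j) = 0}"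
    then have A: "A \<in> indep_cols (Suc n) m" "\<forall>j<m. A $$ (n, j) = 0" by auto
    from restrict[OF indep_cols_carrier[OF A(1)] A(2)] A(1)
    have "append_zero_row (mat n m (($$) A)) \<in> indep_cols (Suc n) m" by simp
    then show "mat n m (($$) A) \<in> indep_cols n m" by (subst (asm) indep) simp_all
  qed
qed

lemma mat_trace_append_col:
  assumes "A \<in> carrier_mat (Suc n) n"
  shows "mat_trace (append_col A x) = (\<Sum>i<n. A $$ (i, i)) + x $ n"
  using assms by (simp add: mat_trace_def append_col_def)

text \<open>The last column enters the trace only through its coordinate \<open>n\<close>, the last
  one in counting from 0. The sum over all columns therefore cancels, and the sum over the span
  survives only for those \<open>A\<close> whose row \<open>n\<close> is zero.\<close>

lemma sum_mat_trace_Suc: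
  fixes f :: "'a::{field,finite} \<Rightarrow> real"
  assumes f: "sum f UNIV = 0"
  shows "(\<Sum>X\<in>indep_cols (Suc n) (Suc n). f (mat_trace X)) =
    - (real CARD('a) ^ n) * (\<Sum>X\<in>indep_cols n n. f (mat_trace X))"
proof -
  let ?t = "\<lambda>A :: 'a mat. \<Sum>i<n. A $$ (i, i)"
  let ?Z = "{A \<in> indep_cols (Suc n) n. \<forall>j<n. A $$ (n, j) = (0 :: 'a)}"
  have full: "(\<Sum>x\<in>carrier_vec (Suc n). f (t + x $ n)) = 0" for t
    by (rule sum_linear_functional_eq_0[OF f, of "unit_vec (Suc n) n"]) auto
  have nonzero: "(\<Sum>c\<in>carrier_vec n. f (t + (A *\<^sub>v c) $ n)) = 0"
    if A: "A \<in> carrier_mat (Suc n) n" and j: "j < n" "A $$ (n, j) \<noteq> 0" for A t j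
  \<comment> \<open>The unit vector at a nonzero entry of row \<open>n\<close>, scaled so that the
    last coordinate of its image under \<open>A\<close> is 1.\<close>
  proof (rule sum_linear_functional_eq_0[OF f, of "inverse (A $$ (n, j)) \<cdot>\<^sub>v unit_vec n j"])
    show "(A *\<^sub>v (inverse (A $$ (n, j)) \<cdot>\<^sub>v unit_vec n j)) $ n = 1"
      using A j by (simp add: mult_mat_vec[OF A])
    show "(A *\<^sub>v (c + s \<cdot>\<^sub>v (inverse (A $$ (n, j)) \<cdot>\<^sub>v unit_vec n j))) $ n =
      (A *\<^sub>v c) $ n + s * (A *\<^sub>v (inverse (A $$ (n, j)) \<cdot>\<^sub>v unit_vec n j)) $ n"
      if "c \<in> carrier_vec n" for c s
      using A that by (simp add: mult_mat_vec[OF A] mult_add_distrib_mat_vec[OF A])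
  qed simp
  \<comment> \<open>With row \<open>n\<close> zero the summand is independent of \<open>c\<close>,
    so it is counted once for each of the vectors in \<open>carrier_vec n\<close>.\<close>
  have zero: "(\<Sum>c\<in>carrier_vec n. f (?t A + (A *\<^sub>v c) $ n)) = real CARD('a) ^ n * f (?t A)"
    if "A \<in> ?Z" for A
  proof -
    have "(A *\<^sub>v c) $ n = 0" if "c \<in> carrier_vec n" for c
      using \<open>A \<in> ?Z\<close> that by (auto dest!: indep_cols_carrier simp: scalar_prod_def)
    then show ?thesis by (simp add: card_carrier_vec)
  qed
  have "(\<Sum>X\<in>indep_cols (Suc n) (Suc n). f (mat_trace X)) =
    (\<Sum>A\<in>indep_cols (Suc n) n. - (\<Sum>c\<in>carrier_vec n. f (?t A + (A *\<^sub>v c) $ n)))"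
    unfolding sum_indep_cols_Suc
    by (intro sum.cong refl) (simp add: mat_trace_append_col[OF indep_cols_carrier] full)
  also have "\<dots> = (\<Sum>A\<in>?Z. - (\<Sum>c\<in>carrier_vec n. f (?t A + (A *\<^sub>v c) $ n)))"
    by (rule sum.mono_neutral_right)
      (auto simp: finite_indep_cols intro!: nonzero dest: indep_cols_carrier)
  also have "\<dots> = (\<Sum>A\<in>?Z. - (real CARD('a) ^ n) * f (?t A))"
    using zero by (intro sum.cong) auto
  also have "\<dots> = - (real CARD('a) ^ n) * (\<Sum>A\<in>?Z. f (?t A))"
    by (simp only: sum_distrib_left)
  \<comment> \<open>Matrices in \<open>?Z\<close> are invertible ones of size \<open>n\<close> with
    a zero row below, so \<open>?t\<close> is the trace of the upper block.\<close>
  also have "(\<Sum>A\<in>?Z. f (?t A)) = (\<Sum>X\<in>indep_cols n n. f (?t (append_zero_row X)))"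
    by (rule sum.reindex_bij_betw[OF bij_betw_append_zero_row, symmetric])
  also have "\<dots> = (\<Sum>X\<in>indep_cols n n. f (mat_trace X))"
    by (intro sum.cong refl arg_cong[of _ _ f])
      (auto simp: mat_trace_def append_zero_row_def dest!: indep_cols_carrier intro!: sum.cong)
  finally show ?thesis .
qed

text \<open>The recursion descends to the empty matrix, whose trace is 0, hence the factor
  \<open>f 0\<close>. The exponents collected on the way are 0, ..., n - 1, with sum
  \<open>n choose 2\<close>.\<close>

lemma sum_mat_trace:
  fixes f :: "'a::{field,finite} \<Rightarrow> real"
  assumes "sum f UNIV = 0"
  shows "(\<Sum>X\<in>indep_cols n n. f (mat_trace X)) = (-1) ^ n * real CARD('a) ^ (n choose 2) * f 0"
proof (induction n)
  case 0
  show ?case by (simp add: indep_cols_0 mat_trace_def numeral_2_eq_2)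
next
  case (Suc n)
  have "Suc n choose 2 = n + (n choose 2)" by (simp add: numeral_2_eq_2)
  then show ?case by (simp add: sum_mat_trace_Suc[OF assms] Suc.IH power_add)
qed

section \<open>From trace sums to the counts\<close>

lemma num_GL_trace_eq_sum:
  "real (num_GL_trace n \<beta>) = (\<Sum>X\<in>indep_cols n n. of_bool (mat_trace X = \<beta>))"
  by (simp add: num_GL_trace_def GL_eq_indep_cols finite_indep_cols Int_def)

lemma num_GL_trace_diff:
  fixes h :: "'a::{field,finite}"
  assumes "h \<noteq> 0"
  shows "real (num_GL_trace n (0 :: 'a)) - real (num_GL_trace n h) =
    (-1) ^ n * real CARD('a) ^ (n choose 2)"
proof -
  define f :: "'a \<Rightarrow> real" where "f x = of_bool (x = 0) - of_bool (x = h)" for x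
  have "sum f UNIV = 0" by (simp add: f_def sum_subtractf)
  \<comment> \<open>Since \<open>h\<close> is nonzero, \<open>f 0 = 1\<close>.\<close>
  from sum_mat_trace[OF this, of n] show ?thesis
    using assms by (simp add: num_GL_trace_eq_sum f_def sum_subtractf)
qed

text \<open>Every matrix has exactly one trace, so after exchanging the sums each contributes
  1.\<close>

lemma sum_num_GL_trace:
  "(\<Sum>\<beta>\<in>UNIV. real (num_GL_trace n (\<beta> :: 'a::{field,finite}))) =
     real (card (indep_cols n n :: 'a mat set))"
  unfolding num_GL_trace_eq_sum by (subst sum.swap) simp

text \<open>Pull \<open>x ^ i\<close> out of the factor with index \<open>i\<close> and reverse the
  order of the remaining factors. This puts the order of the general linear group into the form used
  in the final formula.\<close>

lemma prod_diff_powers: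
  "(\<Prod>i<n. x ^ n - x ^ i) = x ^ (n choose 2) * (\<Prod>i=1..n. x ^ i - (1 :: real))"
proof -
  have "(\<Prod>i<n. x ^ n - x ^ i) = (\<Prod>i<n. x ^ i * (x ^ (n - i) - 1))"
    by (intro prod.cong refl) (simp add: algebra_simps flip: power_add)
  also have "\<dots> = (\<Prod>i<n. x ^ i) * (\<Prod>i<n. x ^ (n - i) - 1)" by (rule prod.distrib)
  also have "(\<Prod>i<n. x ^ i) = x ^ (n choose 2)"
    by (induction n) (simp_all add: numeral_2_eq_2 power_add)
  also have "(\<Prod>i<n. x ^ (n - i) - 1) = (\<Prod>i=1..n. x ^ i - 1)"
    by (rule prod.reindex_bij_witness[of _ "\<lambda>i. n - i" "\<lambda>i. n - i"]) auto
  finally show ?thesis .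
qed

theorem theorem3p1:
  fixes h :: "'k::{field,finite}" and n q :: nat
  assumes q: "q = CARD('k)"
    and n: "n \<ge> 1"
    and h: "h \<noteq> 0"
  shows "real (num_GL_trace n (0::'k)) =
           real q ^ (n choose 2) * (real q - 1) / real q *
             ((-1) ^ n + (\<Prod>i=2..n. (real q ^ i - 1)))
         \<and> real (num_GL_trace n h) =
           real q ^ (n choose 2) * (real q - 1) / real q *
             ((-1) ^ (n - 1) / (real q - 1) + (\<Prod>i=2..n. (real q ^ i - 1)))"
proof -
  define Q P D N0 where "Q = real q" and "P = (\<Prod>i=2..n. Q ^ i - 1)"
    and "D = Q ^ (n choose 2)" and "N0 = real (num_GL_trace n (0::'k))"
  \<comment> \<open>A field has at least two elements; this justifies the later divisions by
    \<open>Q\<close> and \<open>Q - 1\<close>.\<close>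
  have "card {0, 1 :: 'k} \<le> CARD('k)" by (rule card_mono) auto
  then have Q: "Q > 1" unfolding Q_def q by simp
  have diff: "real (num_GL_trace n \<beta>) = N0 - (-1) ^ n * D" if "\<beta> \<noteq> 0" for \<beta> :: 'k
    using num_GL_trace_diff[OF that, of n] by (simp add: N0_def D_def Q_def q)
  \<comment> \<open>All \<open>Q - 1\<close> nonzero traces have the same count, so the total gives
    a linear equation for \<open>N0\<close>.\<close>
  have "N0 + (Q - 1) * (N0 - (-1) ^ n * D) = (\<Sum>\<beta>\<in>UNIV. real (num_GL_trace n (\<beta> :: 'k)))"
    using diff Q by (subst sum.remove[of _ 0]) (auto simp: N0_def Q_def q card_Diff_singleton of_nat_diff)
  also have "\<dots> = D * (\<Prod>i=1..n. Q ^ i - 1)"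
    by (simp add: sum_num_GL_trace card_indep_cols prod_diff_powers D_def Q_def q)
  \<comment> \<open>The factor \<open>i = 1\<close> exists because \<open>n \<ge> 1\<close>.\<close>
  also have "(\<Prod>i=1..n. Q ^ i - 1) = (Q - 1) * P"
    unfolding P_def using n by (subst prod.atLeast_Suc_atMost) (auto simp: numeral_2_eq_2)
  finally have eq: "Q * N0 = D * (Q - 1) * ((-1) ^ n + P)" by (simp add: algebra_simps)
  have N0: "N0 = D * (Q - 1) / Q * ((-1) ^ n + P)" using eq Q by (simp add: field_simps)
  have sign: "(-1 :: real) ^ n = - ((-1) ^ (n - 1))" using n by (cases n) auto
  \<comment> \<open>Subtracting \<open>(-1) ^ n * D\<close> turns the coefficient
    \<open>(Q - 1) / Q\<close> of that term into \<open>- 1 / Q\<close>, which accounts for both the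
    changed sign and the division by \<open>Q - 1\<close>.\<close>
  have "real (num_GL_trace n h) = D * (Q - 1) / Q * ((-1) ^ (n - 1) / (Q - 1) + P)"
    unfolding diff[OF h] N0 sign using Q by (simp add: divide_simps) (simp add: algebra_simps)
  with N0 show ?thesis by (simp add: N0_def D_def P_def Q_def)
qed

end
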